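(* Let $\mathcal{A}\in\mathbb{C}^{I_{1}\times\cdots\times I_{M}\times J_{1}\times\cdots\times J_{N}}$ and $\mathcal{B}\in\mathbb{C}^{J_{1}\times\cdots\times J_{N}\times K_{1}\times\cdots\times K_{L}}$. Then $(\mathcal{A}*_N\mathcal{B})^{\dagger}=\mathcal{B}^{\dagger}*_N\mathcal{A}^{\dagger}$ if and only if all three of the following conditions hold: (i) $\mathcal{A}^{\dagger}*_M\mathcal{A}*_N\mathcal{B}*_L\mathcal{B}^{\dagger}=\mathcal{B}*_L\mathcal{B}^{\dagger}*_N\mathcal{A}^{\dagger}*_M\mathcal{A}$; (ii) $(\mathcal{A}*_N\mathcal{B}*_L\mathcal{B}^{\dagger}*_N\mathcal{A}^{\dagger})^{H}=\mathcal{A}*_N\mathcal{B}*_L\mathcal{B}^{\dagger}*_N\mathcal{A}^{\dagger}$; (iii) $(\mathcal{B}^{\dagger}*_N\mathcal{A}^{\dagger}*_M\mathcal{A}*_N\mathcal{B})^{H}=\mathcal{B}^{\dagger}*_N\mathcal{A}^{\dagger}*_M\mathcal{A}*_N\mathcal{B}$.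
   Context: Einstein product: for $\mathcal{A}\in\mathbb{C}^{I_1\times\cdots\times I_M\times J_1\times\cdots\times J_N}$ and $\mathcal{B}\in\mathbb{C}^{J_1\times\cdots\times J_N\times K_1\times\cdots\times K_L}$, $(\mathcal{A}*_N\mathcal{B})_{i_1\cdots i_Mk_1\cdots k_L}=\sum_{j_1,\dots,j_N}a_{i_1\cdots i_Mj_1\cdots j_N}b_{j_1\cdots j_Nk_1\cdots k_L}$; the subscript indicates the number of contracted modes ($*_M$, $*_L$ are analogous). Conjugate transpose: $(\mathcal{A}^H)_{j_1\cdots j_Ni_1\cdots i_M}=\overline{a_{i_1\cdots i_Mj_1\cdots j_N}}$. Moore--Penrose inverse: for $\mathcal{X}\in\mathbb{C}^{I_1\times\cdots\times I_M\times J_1\times\cdots\times J_N}$, $\mathcal{X}^\dagger$ is the unique $\mathcal{Y}\in\mathbb{C}^{J_1\times\cdots\times J_N\times I_1\times\cdots\times I_M}$ with (1) $\mathcal{X}*_N\mathcal{Y}*_M\mathcal{X}=\mathcal{X}$, (2) $\mathcal{Y}*_M\mathcal{X}*_N\mathcal{Y}=\mathcal{Y}$, (3) $(\mathcal{X}*_N\mathcal{Y})^H=\mathcal{X}*_N\mathcal{Y}$, (4) $(\mathcal{Y}*_M\mathcal{X})^H=\mathcal{Y}*_M\mathcal{X}$. *)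

theory Defs
  imports Complex_Main
begin

text \<open>
  A complex tensor carries its list of mode sizes and its entries, so the order and the mode sizes
  may vary freely. The multi-indices of a tensor of size \<open>ds = [d1, \<dots>, dk]\<close> are the lists
  \<open>[i1, \<dots>, ik]\<close> with \<open>ij < dj\<close>, that is, indices count from 0. Entries outside this range are fixed
  to be 0, so that equality of tensors is equality of sizes and of entries.
\<close>

definition multi_indices :: "nat list \<Rightarrow> nat list set" where
  "multi_indices ds = {is. list_all2 (<) is ds}"

typedef tensor = "{(ds :: nat list, f :: nat list \<Rightarrow> complex). \<forall>is. is \<notin> multi_indices ds \<longrightarrow> f is = 0}"
  by (rule exI[of _ "([], \<lambda>_. 0)"]) simp

definition dims :: "tensor \<Rightarrow> nat list" where
  "dims A = fst (Rep_tensor A)"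

definition entry :: "tensor \<Rightarrow> nat list \<Rightarrow> complex" where
  "entry A = snd (Rep_tensor A)"

definition make_tensor :: "nat list \<Rightarrow> (nat list \<Rightarrow> complex) \<Rightarrow> tensor" where
  "make_tensor ds f = Abs_tensor (ds, \<lambda>is. if is \<in> multi_indices ds then f is else 0)"

definition tensor_order :: "tensor \<Rightarrow> nat" where
  "tensor_order A = length (dims A)"

definition tensor_space :: "nat list \<Rightarrow> tensor set" where
  "tensor_space ds = {A. dims A = ds}"

text \<open>
  The Einstein product contracts the last \<open>N\<close> modes of \<open>A\<close> with the first \<open>N\<close> modes of \<open>B\<close>. It is
  meaningful only when these modes have the same sizes; the lemma \<open>entry_einstein\<close> below gives the
  entries in that case.
\<close>

definition einstein :: "tensor \<Rightarrow> nat \<Rightarrow> tensor \<Rightarrow> tensor"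
    ("(_ *\<^bsub>_\<^esub> _)" [70, 0, 71] 70) where
  "A *\<^bsub>N\<^esub> B =
     (let m = tensor_order A - N in
      make_tensor (take m (dims A) @ drop N (dims B))
        (\<lambda>is. \<Sum>js\<in>multi_indices (take N (dims B)).
               entry A (take m is @ js) * entry B (js @ drop m is)))"

text \<open>
  The conjugate transpose and the Moore--Penrose inverse depend on how the modes of a tensor are
  split into a row block and a column block. The subscript \<open>M\<close> is the number of modes in the row
  block, that is, the modes preceding the split.
\<close>

definition conj_transpose :: "tensor \<Rightarrow> nat \<Rightarrow> tensor"
    ("(_\<^sup>H\<^bsub>_\<^esub>)" [1000, 0] 1000) where
  "A\<^sup>H\<^bsub>M\<^esub> =
     (let n = tensor_order A - M in
      make_tensor (drop M (dims A) @ take M (dims A))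
        (\<lambda>is. cnj (entry A (drop n is @ take n is))))"

definition is_mp_inverse :: "nat \<Rightarrow> tensor \<Rightarrow> tensor \<Rightarrow> bool" where
  "is_mp_inverse M X Y \<longleftrightarrow>
     (let N = tensor_order X - M in
      Y \<in> tensor_space (drop M (dims X) @ take M (dims X)) \<and>
      X *\<^bsub>N\<^esub> Y *\<^bsub>M\<^esub> X = X \<and>
      Y *\<^bsub>M\<^esub> X *\<^bsub>N\<^esub> Y = Y \<and>
      (X *\<^bsub>N\<^esub> Y)\<^sup>H\<^bsub>M\<^esub> = X *\<^bsub>N\<^esub> Y \<and>
      (Y *\<^bsub>M\<^esub> X)\<^sup>H\<^bsub>N\<^esub> = Y *\<^bsub>M\<^esub> X)"

definition mp_inverse :: "tensor \<Rightarrow> nat \<Rightarrow> tensor"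
    ("(_\<^sup>\<dagger>\<^bsub>_\<^esub>)" [1000, 0] 1000) where
  "X\<^sup>\<dagger>\<^bsub>M\<^esub> = (THE Y. is_mp_inverse M X Y)"

lemma Rep_make_tensor:
  "Rep_tensor (make_tensor ds f) = (ds, \<lambda>is. if is \<in> multi_indices ds then f is else 0)"
  unfolding make_tensor_def by (rule Abs_tensor_inverse) simp

lemma dims_make_tensor [simp]: "dims (make_tensor ds f) = ds"
  by (simp add: dims_def Rep_make_tensor)

lemma entry_make_tensor:
  "entry (make_tensor ds f) is = (if is \<in> multi_indices ds then f is else 0)"
  by (simp add: entry_def Rep_make_tensor)

lemma entry_outside: "is \<notin> multi_indices (dims A) \<Longrightarrow> entry A is = 0"
  using Rep_tensor[of A] by (auto simp: entry_def dims_def split: prod.splits)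

lemma tensor_eqI:
  assumes "dims A = dims B"
    and "\<And>is. is \<in> multi_indices (dims A) \<Longrightarrow> entry A is = entry B is"
  shows "A = B"
proof -
  have "entry A = entry B"
    using assms entry_outside by (metis ext)
  with assms(1) show ?thesis
    by (metis Rep_tensor_inject dims_def entry_def prod_eqI)
qed

lemma length_multi_indices: "is \<in> multi_indices ds \<Longrightarrow> length is = length ds"
  by (simp add: multi_indices_def list_all2_lengthD)

lemma append_in_multi_indices:
  "is \<in> multi_indices ds \<Longrightarrow> js \<in> multi_indices es \<Longrightarrow> is @ js \<in> multi_indices (ds @ es)"
  by (simp add: multi_indices_def list_all2_appendI)

lemma dims_einstein:
  assumes "A \<in> tensor_space (I @ J)" "B \<in> tensor_space (J @ K)"
  shows "A *\<^bsub>length J\<^esub> B \<in> tensor_space (I @ K)"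
  using assms by (simp add: tensor_space_def einstein_def Let_def tensor_order_def)

lemma entry_einstein:
  assumes "A \<in> tensor_space (I @ J)" "B \<in> tensor_space (J @ K)"
    and "is \<in> multi_indices I" "ks \<in> multi_indices K"
  shows "entry (A *\<^bsub>length J\<^esub> B) (is @ ks) =
           (\<Sum>js\<in>multi_indices J. entry A (is @ js) * entry B (js @ ks))"
  using assms length_multi_indices[OF assms(3)]
  by (simp add: tensor_space_def einstein_def Let_def tensor_order_def entry_make_tensor
      append_in_multi_indices)

lemma dims_conj_transpose:
  assumes "A \<in> tensor_space (I @ J)"
  shows "A\<^sup>H\<^bsub>length I\<^esub> \<in> tensor_space (J @ I)"
  using assms by (simp add: tensor_space_def conj_transpose_def Let_def)

lemma entry_conj_transpose:
  assumes "A \<in> tensor_space (I @ J)"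
    and "is \<in> multi_indices I" "js \<in> multi_indices J"
  shows "entry (A\<^sup>H\<^bsub>length I\<^esub>) (js @ is) = cnj (entry A (is @ js))"
  using assms length_multi_indices[OF assms(3)]
  by (simp add: tensor_space_def conj_transpose_def Let_def tensor_order_def entry_make_tensor
      append_in_multi_indices)

end

theory Submission
  imports Defs "HOL-Library.Function_Algebras"
begin

text \<open>
  Grouping the row modes and the column modes of a tensor turns the Einstein product into a product
  of matrices indexed by finite sets. There \<open>B\<^sup>\<dagger> A\<^sup>\<dagger>\<close> satisfies the first two Penrose equations for
  \<open>A B\<close> iff the orthogonal projectors \<open>P = A\<^sup>\<dagger> A\<close> and \<open>Q = B B\<^sup>\<dagger>\<close> satisfy \<open>P Q P Q = P Q\<close>, and two
  orthogonal projectors with idempotent product commute; (ii) and (iii) are the other two Penrose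
  equations. Moore--Penrose inverses exist because \<open>X\<^sup>H X\<close> has an inner inverse \<open>G\<close>, for which
  \<open>X G X\<^sup>H X = X\<close>.
\<close>

section \<open>Matrices indexed by finite sets\<close>

text \<open>The index sets occurring below are sets of lists, not types, so a matrix is a total
  function and the product carries the set summed over.\<close>

definition mprod :: "('a \<Rightarrow> 'b \<Rightarrow> complex) \<Rightarrow> 'b set \<Rightarrow> ('b \<Rightarrow> 'c \<Rightarrow> complex) \<Rightarrow> 'a \<Rightarrow> 'c \<Rightarrow> complex"
    ("(_ \<cdot>\<^bsub>_\<^esub> _)" [70, 0, 71] 70) where
  "F \<cdot>\<^bsub>J\<^esub> G = (\<lambda>i k. \<Sum>j\<in>J. F i j * G j k)"

definition ct :: "('a \<Rightarrow> 'b \<Rightarrow> complex) \<Rightarrow> 'b \<Rightarrow> 'a \<Rightarrow> complex" where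
  "ct F = (\<lambda>j i. cnj (F i j))"

text \<open>Vanishing off the block makes equality of matrices equality of functions, in line with
  the convention for tensor entries.\<close>

definition supported :: "'a set \<Rightarrow> 'b set \<Rightarrow> ('a \<Rightarrow> 'b \<Rightarrow> complex) \<Rightarrow> bool" where
  "supported I J F \<longleftrightarrow> (\<forall>i j. F i j \<noteq> 0 \<longrightarrow> i \<in> I \<and> j \<in> J)"

lemma mprod_assoc:
  assumes "finite J" "finite K"
  shows "F \<cdot>\<^bsub>J\<^esub> G \<cdot>\<^bsub>K\<^esub> H = F \<cdot>\<^bsub>J\<^esub> (G \<cdot>\<^bsub>K\<^esub> H)"
  unfolding mprod_def
  by (intro ext, simp add: sum_distrib_left sum_distrib_right mult.assoc, rule sum.swap)

lemma ct_mprod [simp]: "ct (F \<cdot>\<^bsub>J\<^esub> G) = ct G \<cdot>\<^bsub>J\<^esub> ct F"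
  by (simp add: ct_def mprod_def mult.commute)

lemma ct_ct [simp]: "ct (ct F) = F"
  by (simp add: ct_def)

lemma supported_ct [simp]: "supported J I (ct F) \<longleftrightarrow> supported I J F"
  by (auto simp: supported_def ct_def)

lemma supported_mprod:
  assumes "supported I J F" "supported J' K G"
  shows "supported I K (F \<cdot>\<^bsub>S\<^esub> G)"
  unfolding supported_def mprod_def
proof (intro allI impI)
  fix i k assume "(\<Sum>j\<in>S. F i j * G j k) \<noteq> 0"
  then obtain j where "F i j * G j k \<noteq> 0" by (meson sum.not_neutral_contains_not_neutral)
  then show "i \<in> I \<and> k \<in> K" using assms by (auto simp: supported_def)
qed

section \<open>Gram matrices and inner inverses\<close>

lemma sum_fun_apply: "(\<Sum>a\<in>S. h a) x = (\<Sum>a\<in>S. h a x)"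
  for h :: "'a \<Rightarrow> 'b \<Rightarrow> 'c::comm_monoid_add"
  by (induction S rule: infinite_finite_induct) auto

text \<open>The Gram matrix of \<open>F - G\<close> is \<open>H - H - H + H = 0\<close>. Its
  diagonal entry at \<open>j\<close> sums the squared moduli of column \<open>j\<close>, so that
  column vanishes on \<open>I\<close>; off \<open>I\<close> both matrices vanish by support. This
  serves to cancel an adjoint on the left.\<close>

lemma eq_if_gram_eq:
  assumes "finite I" and F: "supported I J F" and G: "supported I J' G"
    and "ct F \<cdot>\<^bsub>I\<^esub> F = H" "ct F \<cdot>\<^bsub>I\<^esub> G = H" "ct G \<cdot>\<^bsub>I\<^esub> F = H" "ct G \<cdot>\<^bsub>I\<^esub> G = H"
  shows "F = G"
proof (intro ext)
  fix i j
  show "F i j = G i j"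
  proof (cases "i \<in> I")
    case True
    have e: "(\<Sum>i\<in>I. cnj (X i j) * Y i j) = H j j" if "ct X \<cdot>\<^bsub>I\<^esub> Y = H" for X Y
      using fun_cong[OF fun_cong[OF that, of j], of j] by (simp add: mprod_def ct_def)
    have "complex_of_real (\<Sum>i\<in>I. (cmod (F i j - G i j))\<^sup>2)
        = (\<Sum>i\<in>I. (cnj (F i j) * F i j - cnj (F i j) * G i j)
                 - (cnj (G i j) * F i j - cnj (G i j) * G i j))"
      unfolding of_real_sum
      by (rule sum.cong) (simp_all only: complex_norm_square complex_cnj_diff algebra_simps)
    also have "\<dots> = 0"
      by (simp only: sum_subtractf e assms(4-7)) simp
    finally have "(\<Sum>i\<in>I. (cmod (F i j - G i j))\<^sup>2) = 0" by (simp only: of_real_eq_0_iff)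
    then show ?thesis using True \<open>finite I\<close> by (simp add: sum_nonneg_eq_0_iff)
  next
    case False
    then show ?thesis using F G by (metis supported_def)
  qed
qed

text \<open>A linear map \<open>f\<close> has a linear right inverse \<open>g\<close> on its range, so \<open>f \<circ> g \<circ> f = f\<close>.\<close>

lemma inner_inverse_exists:
  fixes F :: "'a \<Rightarrow> 'b \<Rightarrow> complex"
  assumes I: "finite I" and J: "finite J" and F: "supported I J F"
  obtains G where "supported J I G" "F \<cdot>\<^bsub>J\<^esub> G \<cdot>\<^bsub>I\<^esub> F = F"
proof -
  let ?sa = "\<lambda>(c::complex) (v::'a \<Rightarrow> complex) x. c * v x"
  let ?sb = "\<lambda>(c::complex) (v::'b \<Rightarrow> complex) x. c * v x"
  interpret vb: vector_space ?sb by standard (auto simp: fun_eq_iff algebra_simps)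
  interpret va: vector_space ?sa by standard (auto simp: fun_eq_iff algebra_simps)
  interpret vba: vector_space_pair ?sb ?sa by standard
  define f where "f v i = (\<Sum>j\<in>J. F i j * v j)" for v i
  have "Vector_Spaces.linear ?sb ?sa f"
    by unfold_locales (auto simp: f_def fun_eq_iff algebra_simps sum.distrib sum_distrib_left)
  from vba.linear_exists_right_inverse_on[OF this vb.subspace_UNIV]
  obtain g where g: "Vector_Spaces.linear ?sa ?sb g" and fg: "\<And>v. f (g (f v)) = f v"
    by auto
  interpret g: Vector_Spaces.linear ?sa ?sb g by (rule g)
  define e where "e i = (\<lambda>x. if x = i then 1 else 0 :: complex)" for i :: 'a
  \<comment> \<open>Column \<open>i\<close> of \<open>G\<close> is the image under \<open>g\<close>
    of the unit vector \<open>e i\<close>. Cutting it off outside \<open>J\<close> loses nothing, as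
    \<open>f\<close> reads only values on \<open>J\<close>.\<close>
  define G where "G j i = (if i \<in> I \<and> j \<in> J then g (e i) j else 0)" for j i
  have "F i k = (F \<cdot>\<^bsub>J\<^esub> (G \<cdot>\<^bsub>I\<^esub> F)) i k" for i k
  proof (cases "k \<in> J")
    case True
    \<comment> \<open>The unit vector at \<open>k\<close>, which \<open>f\<close> maps to column
      \<open>k\<close> of \<open>F\<close>; the claim for this column is then
      \<open>f (g (f ?d)) = f ?d\<close>.\<close>
    let ?d = "\<lambda>x. if x = k then 1 else 0 :: complex"
    have fd: "f ?d = (\<lambda>i. F i k)"
      using True J by (simp add: f_def fun_eq_iff if_distrib[of "(*) _"] cong: if_cong)
    \<comment> \<open>By support, column \<open>k\<close> is a combination of the \<open>e i\<close>
      with \<open>i\<close> in \<open>I\<close>, so linearity of \<open>g\<close> identifies its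
      image on \<open>J\<close> with column \<open>k\<close> of \<open>G F\<close>.\<close>
    have F_x: "F x k = (\<Sum>i\<in>I. F i k * e i x)" for x
      using I F by (auto simp: e_def supported_def if_distrib[of "(*) _"] cong: if_cong)
    have F_k: "(\<lambda>i. F i k) = (\<Sum>i\<in>I. ?sa (F i k) (e i))"
      by (rule ext, subst sum_fun_apply, rule F_x)
    have "g (\<lambda>i. F i k) = (\<Sum>i\<in>I. ?sb (F i k) (g (e i)))"
      by (subst F_k) (simp only: g.sum g.scale)
    then have "g (\<lambda>i. F i k) j = (G \<cdot>\<^bsub>I\<^esub> F) j k" if "j \<in> J" for j
      using that by (simp add: mprod_def G_def mult.commute sum_fun_apply)
    then show ?thesis
      using fun_cong[OF fg[of ?d], of i] unfolding fd by (simp add: f_def mprod_def)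
  next
    case False
    then have "F i k = 0" for i using F by (auto simp: supported_def)
    then show ?thesis by (simp add: mprod_def)
  qed
  moreover have "supported J I G" by (auto simp: supported_def G_def)
  ultimately show thesis using that I J by (metis ext mprod_assoc)
qed

section \<open>Moore--Penrose inverses of matrices\<close>

definition penrose ::
    "'a set \<Rightarrow> 'b set \<Rightarrow> ('a \<Rightarrow> 'b \<Rightarrow> complex) \<Rightarrow> ('b \<Rightarrow> 'a \<Rightarrow> complex) \<Rightarrow> bool" where
  "penrose I J X Y \<longleftrightarrow>
     X \<cdot>\<^bsub>J\<^esub> Y \<cdot>\<^bsub>I\<^esub> X = X \<and> Y \<cdot>\<^bsub>I\<^esub> X \<cdot>\<^bsub>J\<^esub> Y = Y \<and>
     ct (X \<cdot>\<^bsub>J\<^esub> Y) = X \<cdot>\<^bsub>J\<^esub> Y \<and> ct (Y \<cdot>\<^bsub>I\<^esub> X) = Y \<cdot>\<^bsub>I\<^esub> X"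

text \<open>\<open>X Y = (X Z)(X Y)\<close>; taking adjoints swaps the two Hermitian factors, so
  \<open>X Y = X Y X Z = X Z\<close>. Dually \<open>Y X = Z X\<close>, whence
  \<open>Y = Y X Y = Z X Z = Z\<close>.\<close>

lemma penrose_unique:
  assumes I: "finite I" and J: "finite J" and Y: "penrose I J X Y" and Z: "penrose I J X Z"
  shows "Y = Z"
proof -
  note as = mprod_assoc[OF I J] mprod_assoc[OF J I] mprod_assoc[OF I I] mprod_assoc[OF J J]
  have "X \<cdot>\<^bsub>J\<^esub> Y = X \<cdot>\<^bsub>J\<^esub> Z \<cdot>\<^bsub>I\<^esub> (X \<cdot>\<^bsub>J\<^esub> Y)"
    using Z unfolding penrose_def by (metis as)
  then have "ct (X \<cdot>\<^bsub>J\<^esub> Y) = ct (X \<cdot>\<^bsub>J\<^esub> Y) \<cdot>\<^bsub>I\<^esub> ct (X \<cdot>\<^bsub>J\<^esub> Z)"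
    by (metis ct_mprod)
  then have "X \<cdot>\<^bsub>J\<^esub> Y = X \<cdot>\<^bsub>J\<^esub> Y \<cdot>\<^bsub>I\<^esub> (X \<cdot>\<^bsub>J\<^esub> Z)"
    using Y Z unfolding penrose_def by simp
  then have 1: "X \<cdot>\<^bsub>J\<^esub> Y = X \<cdot>\<^bsub>J\<^esub> Z"
    using Y unfolding penrose_def by (metis as)
  have "Y \<cdot>\<^bsub>I\<^esub> X = Y \<cdot>\<^bsub>I\<^esub> X \<cdot>\<^bsub>J\<^esub> (Z \<cdot>\<^bsub>I\<^esub> X)"
    using Z unfolding penrose_def by (metis as)
  then have "ct (Y \<cdot>\<^bsub>I\<^esub> X) = ct (Z \<cdot>\<^bsub>I\<^esub> X) \<cdot>\<^bsub>J\<^esub> ct (Y \<cdot>\<^bsub>I\<^esub> X)"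
    by (metis ct_mprod)
  then have "Y \<cdot>\<^bsub>I\<^esub> X = Z \<cdot>\<^bsub>I\<^esub> X \<cdot>\<^bsub>J\<^esub> (Y \<cdot>\<^bsub>I\<^esub> X)"
    using Y Z unfolding penrose_def by simp
  then have 2: "Y \<cdot>\<^bsub>I\<^esub> X = Z \<cdot>\<^bsub>I\<^esub> X"
    using Y unfolding penrose_def by (metis as)
  show ?thesis
    using 1 2 Y Z unfolding penrose_def by (metis as)
qed

text \<open>For \<open>G\<close> an inner inverse of \<open>H = ct X X\<close>, the matrix
  \<open>Z = G (ct X)\<close> makes \<open>X Z\<close> the orthogonal projector onto the range of
  \<open>X\<close>.\<close>

lemma least_squares_inverse_exists:
  assumes I: "finite I" and J: "finite J" and X: "supported I J X"
  obtains Z where "supported J I Z" "X \<cdot>\<^bsub>J\<^esub> Z \<cdot>\<^bsub>I\<^esub> X = X" "ct (X \<cdot>\<^bsub>J\<^esub> Z) = X \<cdot>\<^bsub>J\<^esub> Z"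
proof -
  note as = mprod_assoc[OF I J] mprod_assoc[OF J I] mprod_assoc[OF I I] mprod_assoc[OF J J]
  define H where "H = ct X \<cdot>\<^bsub>I\<^esub> X"
  have "supported J J H" unfolding H_def by (rule supported_mprod) (use X in auto)
  from inner_inverse_exists[OF J J this] obtain G
    where sG: "supported J J G" and G: "H \<cdot>\<^bsub>J\<^esub> G \<cdot>\<^bsub>J\<^esub> H = H" .
  have ctH: "ct H = H" by (simp add: H_def)
  \<comment> \<open>\<open>G\<close> need not be Hermitian, but its adjoint is again an inner
    inverse of the Hermitian \<open>H\<close>.\<close>
  from arg_cong[OF G, of ct] have G': "H \<cdot>\<^bsub>J\<^esub> ct G \<cdot>\<^bsub>J\<^esub> H = H"
    by (simp add: ctH as)
  define Z where "Z = G \<cdot>\<^bsub>J\<^esub> ct X"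
  have sZ: "supported J I Z" unfolding Z_def by (rule supported_mprod[OF sG]) (use X in auto)
  have XZX: "X \<cdot>\<^bsub>J\<^esub> Z \<cdot>\<^bsub>I\<^esub> X = X \<cdot>\<^bsub>J\<^esub> (G \<cdot>\<^bsub>J\<^esub> H)" by (simp add: Z_def H_def as)
  \<comment> \<open>Multiplied by \<open>ct X\<close> on the left, both sides give \<open>H\<close>;
    all four Gram products reduce to \<open>H\<close> by the equations for \<open>G\<close> and
    \<open>ct G\<close>.\<close>
  have 1: "X \<cdot>\<^bsub>J\<^esub> (G \<cdot>\<^bsub>J\<^esub> H) = X"
  proof (rule eq_if_gram_eq[OF I _ X])
    show "supported I J (X \<cdot>\<^bsub>J\<^esub> (G \<cdot>\<^bsub>J\<^esub> H))"
      by (rule supported_mprod[OF X supported_mprod[OF sG \<open>supported J J H\<close>]])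
    show "ct X \<cdot>\<^bsub>I\<^esub> X = H" by (simp add: H_def)
    show XA: "ct X \<cdot>\<^bsub>I\<^esub> (X \<cdot>\<^bsub>J\<^esub> (G \<cdot>\<^bsub>J\<^esub> H)) = H" using G by (metis H_def as)
    show "ct (X \<cdot>\<^bsub>J\<^esub> (G \<cdot>\<^bsub>J\<^esub> H)) \<cdot>\<^bsub>I\<^esub> X = H"
      using G' by (simp add: ctH as flip: H_def)
    have "ct (X \<cdot>\<^bsub>J\<^esub> (G \<cdot>\<^bsub>J\<^esub> H)) \<cdot>\<^bsub>I\<^esub> (X \<cdot>\<^bsub>J\<^esub> (G \<cdot>\<^bsub>J\<^esub> H))
        = H \<cdot>\<^bsub>J\<^esub> ct G \<cdot>\<^bsub>J\<^esub> (ct X \<cdot>\<^bsub>I\<^esub> (X \<cdot>\<^bsub>J\<^esub> (G \<cdot>\<^bsub>J\<^esub> H)))"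
      by (simp add: ctH as)
    then show "ct (X \<cdot>\<^bsub>J\<^esub> (G \<cdot>\<^bsub>J\<^esub> H)) \<cdot>\<^bsub>I\<^esub> (X \<cdot>\<^bsub>J\<^esub> (G \<cdot>\<^bsub>J\<^esub> H)) = H"
      using G' by (simp only: XA)
  qed
  let ?P = "X \<cdot>\<^bsub>J\<^esub> Z"
  have PX: "?P \<cdot>\<^bsub>I\<^esub> X = X" using XZX 1 by simp
  have ctP: "ct ?P = X \<cdot>\<^bsub>J\<^esub> (ct G \<cdot>\<^bsub>J\<^esub> ct X)" by (simp add: Z_def as)
  \<comment> \<open>The range of \<open>ct ?P\<close> lies in that of \<open>X\<close>, which
    \<open>?P\<close> fixes. Hence \<open>ct ?P\<close> is a product of the form
    \<open>?P (ct ?P)\<close>, so it is Hermitian.\<close>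
  have "?P \<cdot>\<^bsub>I\<^esub> ct ?P = ct ?P" unfolding ctP using PX by (metis as)
  then have "ct ?P = ?P" by (metis ct_ct ct_mprod)
  then show thesis using that sZ PX by blast
qed

text \<open>If \<open>Z\<close> satisfies the first and third Penrose equations and \<open>W\<close>
  the first and fourth, then \<open>Y = W X Z\<close> has \<open>X Y = X Z\<close> and
  \<open>Y X = W X\<close>, so it satisfies all four.\<close>

lemma penrose_exists:
  assumes I: "finite I" and J: "finite J" and X: "supported I J X"
  obtains Y where "supported J I Y" "penrose I J X Y"
proof -
  note as = mprod_assoc[OF I J] mprod_assoc[OF J I] mprod_assoc[OF I I] mprod_assoc[OF J J]
  obtain Z where sZ: "supported J I Z" and Z: "X \<cdot>\<^bsub>J\<^esub> Z \<cdot>\<^bsub>I\<^esub> X = X" "ct (X \<cdot>\<^bsub>J\<^esub> Z) = X \<cdot>\<^bsub>J\<^esub> Z"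
    using least_squares_inverse_exists[OF assms] .
  have "supported J I (ct X)" using X by simp
  then obtain V where sV: "supported I J V" and V: "ct X \<cdot>\<^bsub>I\<^esub> V \<cdot>\<^bsub>J\<^esub> ct X = ct X"
      "ct (ct X \<cdot>\<^bsub>I\<^esub> V) = ct X \<cdot>\<^bsub>I\<^esub> V"
    using least_squares_inverse_exists[OF J I] by blast
  \<comment> \<open>Passing to adjoints exchanges the third and fourth equations, so
    \<open>W\<close> comes from a least squares inverse of \<open>ct X\<close>.\<close>
  define W where "W = ct V"
  have sW: "supported J I W" using sV by (simp add: W_def)
  have W: "X \<cdot>\<^bsub>J\<^esub> W \<cdot>\<^bsub>I\<^esub> X = X" "ct (W \<cdot>\<^bsub>I\<^esub> X) = W \<cdot>\<^bsub>I\<^esub> X"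
    using arg_cong[OF V(1), of ct] V(2) by (simp_all add: W_def as)
  define Y where "Y = W \<cdot>\<^bsub>I\<^esub> X \<cdot>\<^bsub>J\<^esub> Z"
  have XY: "X \<cdot>\<^bsub>J\<^esub> Y = X \<cdot>\<^bsub>J\<^esub> Z" unfolding Y_def using W(1) by (metis as)
  have YX: "Y \<cdot>\<^bsub>I\<^esub> X = W \<cdot>\<^bsub>I\<^esub> X" unfolding Y_def using Z(1) by (metis as)
  have "Y \<cdot>\<^bsub>I\<^esub> X \<cdot>\<^bsub>J\<^esub> Y = Y" unfolding YX unfolding Y_def using W(1) by (metis as)
  then have "penrose I J X Y" unfolding penrose_def XY YX using Z W by simp
  moreover have "supported J I Y" unfolding Y_def by (rule supported_mprod[OF supported_mprod[OF sW X] sZ])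
  ultimately show thesis using that by blast
qed

section \<open>Commuting projectors and the reverse order law for matrices\<close>

text \<open>All Gram products of \<open>Q P\<close> and \<open>P Q P\<close> equal
  \<open>P Q P\<close>, so the two coincide. Thus \<open>Q P\<close> is Hermitian and equals its
  adjoint \<open>P Q\<close>.\<close>

lemma projectors_commute:
  assumes J: "finite J" and sP: "supported J J P" and sQ: "supported J J Q"
    and P: "P \<cdot>\<^bsub>J\<^esub> P = P" "ct P = P" and Q: "Q \<cdot>\<^bsub>J\<^esub> Q = Q" "ct Q = Q"
    and PQ: "P \<cdot>\<^bsub>J\<^esub> Q \<cdot>\<^bsub>J\<^esub> (P \<cdot>\<^bsub>J\<^esub> Q) = P \<cdot>\<^bsub>J\<^esub> Q"
  shows "P \<cdot>\<^bsub>J\<^esub> Q = Q \<cdot>\<^bsub>J\<^esub> P"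
proof -
  note as = mprod_assoc[OF J J]
  \<comment> \<open>The trailing factor \<open>R\<close> lets these equations rewrite inside
    right-nested products.\<close>
  have P': "P \<cdot>\<^bsub>J\<^esub> (P \<cdot>\<^bsub>J\<^esub> R) = P \<cdot>\<^bsub>J\<^esub> R" and Q': "Q \<cdot>\<^bsub>J\<^esub> (Q \<cdot>\<^bsub>J\<^esub> R) = Q \<cdot>\<^bsub>J\<^esub> R"
    and PQ': "P \<cdot>\<^bsub>J\<^esub> (Q \<cdot>\<^bsub>J\<^esub> (P \<cdot>\<^bsub>J\<^esub> (Q \<cdot>\<^bsub>J\<^esub> R))) = P \<cdot>\<^bsub>J\<^esub> (Q \<cdot>\<^bsub>J\<^esub> R)" for R
    using P Q PQ by (metis as)+
  have sQP: "supported J J (Q \<cdot>\<^bsub>J\<^esub> P)" by (rule supported_mprod[OF sQ sP])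
  have "Q \<cdot>\<^bsub>J\<^esub> P = P \<cdot>\<^bsub>J\<^esub> (Q \<cdot>\<^bsub>J\<^esub> P)"
    by (rule eq_if_gram_eq[OF J sQP supported_mprod[OF sP sQP], of "P \<cdot>\<^bsub>J\<^esub> (Q \<cdot>\<^bsub>J\<^esub> P)"])
      (simp_all add: as P Q P' Q' PQ')
  moreover have "ct (P \<cdot>\<^bsub>J\<^esub> (Q \<cdot>\<^bsub>J\<^esub> P)) = P \<cdot>\<^bsub>J\<^esub> (Q \<cdot>\<^bsub>J\<^esub> P)"
    by (simp add: as P Q)
  ultimately have "ct (Q \<cdot>\<^bsub>J\<^esub> P) = Q \<cdot>\<^bsub>J\<^esub> P" by simp
  then show ?thesis by (simp add: P Q)
qed

text \<open>The first two Penrose equations read \<open>A Q P B = A B\<close> and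
  \<open>B' P Q A' = B' A'\<close>. The first forces \<open>P Q = Q P\<close>; conversely, after
  commuting, \<open>A P = A\<close>, \<open>Q B = B\<close>, \<open>P A' = A'\<close> and
  \<open>B' Q = B'\<close> yield both.\<close>

lemma penrose_mprod_iff:
  assumes I: "finite I" and J: "finite J" and K: "finite K"
    and sA: "supported I J A" and sB: "supported J K B"
    and sA': "supported J I A'" and sB': "supported K J B'"
    and A: "penrose I J A A'" and B: "penrose J K B B'"
  shows "penrose I K (A \<cdot>\<^bsub>J\<^esub> B) (B' \<cdot>\<^bsub>J\<^esub> A') \<longleftrightarrow>
    A' \<cdot>\<^bsub>I\<^esub> A \<cdot>\<^bsub>J\<^esub> B \<cdot>\<^bsub>K\<^esub> B' = B \<cdot>\<^bsub>K\<^esub> B' \<cdot>\<^bsub>J\<^esub> A' \<cdot>\<^bsub>I\<^esub> A \<and>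
    ct (A \<cdot>\<^bsub>J\<^esub> B \<cdot>\<^bsub>K\<^esub> B' \<cdot>\<^bsub>J\<^esub> A') = A \<cdot>\<^bsub>J\<^esub> B \<cdot>\<^bsub>K\<^esub> B' \<cdot>\<^bsub>J\<^esub> A' \<and>
    ct (B' \<cdot>\<^bsub>J\<^esub> A' \<cdot>\<^bsub>I\<^esub> A \<cdot>\<^bsub>J\<^esub> B) = B' \<cdot>\<^bsub>J\<^esub> A' \<cdot>\<^bsub>I\<^esub> A \<cdot>\<^bsub>J\<^esub> B"
proof -
  note as = mprod_assoc[OF I J] mprod_assoc[OF J I] mprod_assoc[OF I I] mprod_assoc[OF J J]
    mprod_assoc[OF I K] mprod_assoc[OF K I] mprod_assoc[OF K K] mprod_assoc[OF J K]
    mprod_assoc[OF K J]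
  define P where "P = A' \<cdot>\<^bsub>I\<^esub> A"
  define Q where "Q = B \<cdot>\<^bsub>K\<^esub> B'"
  have sP: "supported J J P" and sQ: "supported J J Q"
    unfolding P_def Q_def using supported_mprod sA sA' sB sB' by blast+
  have P: "P \<cdot>\<^bsub>J\<^esub> P = P" "ct P = P" and Q: "Q \<cdot>\<^bsub>J\<^esub> Q = Q" "ct Q = Q"
    using A B unfolding penrose_def P_def Q_def by (metis as)+
  have AP: "A \<cdot>\<^bsub>J\<^esub> P = A" "P \<cdot>\<^bsub>J\<^esub> A' = A'" and QB: "Q \<cdot>\<^bsub>J\<^esub> B = B" "B' \<cdot>\<^bsub>J\<^esub> Q = B'"
    using A B unfolding penrose_def P_def Q_def by (metis as)+
  have c1: "A' \<cdot>\<^bsub>I\<^esub> A \<cdot>\<^bsub>J\<^esub> B \<cdot>\<^bsub>K\<^esub> B' = P \<cdot>\<^bsub>J\<^esub> Q" "B \<cdot>\<^bsub>K\<^esub> B' \<cdot>\<^bsub>J\<^esub> A' \<cdot>\<^bsub>I\<^esub> A = Q \<cdot>\<^bsub>J\<^esub> P"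
    by (simp_all add: P_def Q_def as)
  have c2: "A \<cdot>\<^bsub>J\<^esub> B \<cdot>\<^bsub>K\<^esub> B' \<cdot>\<^bsub>J\<^esub> A' = A \<cdot>\<^bsub>J\<^esub> B \<cdot>\<^bsub>K\<^esub> (B' \<cdot>\<^bsub>J\<^esub> A')"
    "B' \<cdot>\<^bsub>J\<^esub> A' \<cdot>\<^bsub>I\<^esub> A \<cdot>\<^bsub>J\<^esub> B = B' \<cdot>\<^bsub>J\<^esub> A' \<cdot>\<^bsub>I\<^esub> (A \<cdot>\<^bsub>J\<^esub> B)"
    by (simp_all add: as)
  have p1: "A \<cdot>\<^bsub>J\<^esub> B \<cdot>\<^bsub>K\<^esub> (B' \<cdot>\<^bsub>J\<^esub> A') \<cdot>\<^bsub>I\<^esub> (A \<cdot>\<^bsub>J\<^esub> B) = A \<cdot>\<^bsub>J\<^esub> (Q \<cdot>\<^bsub>J\<^esub> P) \<cdot>\<^bsub>J\<^esub> B"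
    and p2: "B' \<cdot>\<^bsub>J\<^esub> A' \<cdot>\<^bsub>I\<^esub> (A \<cdot>\<^bsub>J\<^esub> B) \<cdot>\<^bsub>K\<^esub> (B' \<cdot>\<^bsub>J\<^esub> A') = B' \<cdot>\<^bsub>J\<^esub> (P \<cdot>\<^bsub>J\<^esub> Q) \<cdot>\<^bsub>J\<^esub> A'"
    by (simp_all add: P_def Q_def as)
  have "P \<cdot>\<^bsub>J\<^esub> Q = Q \<cdot>\<^bsub>J\<^esub> P" if "A \<cdot>\<^bsub>J\<^esub> (Q \<cdot>\<^bsub>J\<^esub> P) \<cdot>\<^bsub>J\<^esub> B = A \<cdot>\<^bsub>J\<^esub> B"
  proof (rule projectors_commute[OF J sP sQ P Q])
    \<comment> \<open>Sandwiching between \<open>A'\<close> and \<open>B'\<close> turns the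
      assumption into \<open>P Q P Q = P Q\<close>.\<close>
    have "A' \<cdot>\<^bsub>I\<^esub> (A \<cdot>\<^bsub>J\<^esub> (Q \<cdot>\<^bsub>J\<^esub> P) \<cdot>\<^bsub>J\<^esub> B) \<cdot>\<^bsub>K\<^esub> B' = A' \<cdot>\<^bsub>I\<^esub> (A \<cdot>\<^bsub>J\<^esub> B) \<cdot>\<^bsub>K\<^esub> B'"
      by (simp only: that)
    then show "P \<cdot>\<^bsub>J\<^esub> Q \<cdot>\<^bsub>J\<^esub> (P \<cdot>\<^bsub>J\<^esub> Q) = P \<cdot>\<^bsub>J\<^esub> Q"
      by (simp add: P_def Q_def as)
  qed
  moreover have "A \<cdot>\<^bsub>J\<^esub> (Q \<cdot>\<^bsub>J\<^esub> P) \<cdot>\<^bsub>J\<^esub> B = A \<cdot>\<^bsub>J\<^esub> B" "B' \<cdot>\<^bsub>J\<^esub> (P \<cdot>\<^bsub>J\<^esub> Q) \<cdot>\<^bsub>J\<^esub> A' = B' \<cdot>\<^bsub>J\<^esub> A'"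
    if "P \<cdot>\<^bsub>J\<^esub> Q = Q \<cdot>\<^bsub>J\<^esub> P"
    using that AP QB by (metis as)+
  ultimately show ?thesis
    unfolding penrose_def c1 c2 p1 p2 by blast
qed

section \<open>Tensors as matrices\<close>

text \<open>The split into row and column modes is an argument because a tensor does not record
  it.\<close>

definition matrix :: "nat list \<Rightarrow> nat list \<Rightarrow> tensor \<Rightarrow> nat list \<Rightarrow> nat list \<Rightarrow> complex" where
  "matrix I J X = (\<lambda>is js.
     if is \<in> multi_indices I \<and> js \<in> multi_indices J then entry X (is @ js) else 0)"

lemma finite_multi_indices [simp]: "finite (multi_indices ds)"
proof (rule finite_subset)
  \<comment> \<open>Inserting 0 keeps \<open>Max\<close> defined when \<open>ds\<close> is
    empty.\<close>
  show "multi_indices ds \<subseteq> {is. set is \<subseteq> {..<Max (insert 0 (set ds))} \<and> length is = length ds}"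
    by (auto simp: multi_indices_def list_all2_conv_all_nth in_set_conv_nth)
      (metis List.finite_set Max_ge finite_insert insertCI nth_mem order_less_le_trans)
  show "finite {is. set is \<subseteq> {..<Max (insert 0 (set ds))} \<and> length is = length ds}"
    by (rule finite_lists_length_eq) simp
qed

lemma multi_indices_append_iff:
  "is \<in> multi_indices (ds @ es) \<longleftrightarrow>
     (\<exists>js ks. is = js @ ks \<and> js \<in> multi_indices ds \<and> ks \<in> multi_indices es)"
  by (auto simp: multi_indices_def list_all2_append2 dest: list_all2_lengthD)

lemma supported_matrix [simp]: "supported (multi_indices I) (multi_indices J) (matrix I J X)"
  by (auto simp: supported_def matrix_def)

lemma matrix_inject:
  assumes "X \<in> tensor_space (I @ J)" "Y \<in> tensor_space (I @ J)"
  shows "matrix I J X = matrix I J Y \<longleftrightarrow> X = Y"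
proof
  assume eq: "matrix I J X = matrix I J Y"
  show "X = Y"
  proof (rule tensor_eqI)
    fix "is" assume "is \<in> multi_indices (dims X)"
    then obtain js ks where "is = js @ ks" "js \<in> multi_indices I" "ks \<in> multi_indices J"
      using assms by (auto simp: tensor_space_def multi_indices_append_iff)
    then show "entry X is = entry Y is"
      using fun_cong[OF fun_cong[OF eq, of js], of ks] by (simp add: matrix_def)
  qed (use assms in \<open>simp add: tensor_space_def\<close>)
qed simp

text \<open>Brings a Moore--Penrose inverse found among matrices back to a tensor.\<close>

lemma matrix_surj:
  assumes "supported (multi_indices I) (multi_indices J) F"
  obtains X where "X \<in> tensor_space (I @ J)" "matrix I J X = F"
proof
  let ?X = "make_tensor (I @ J) (\<lambda>is. F (take (length I) is) (drop (length I) is))"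
  show "?X \<in> tensor_space (I @ J)" by (simp add: tensor_space_def)
  show "matrix I J ?X = F"
    using assms
    by (auto simp: matrix_def supported_def fun_eq_iff entry_make_tensor append_in_multi_indices
        length_multi_indices)
qed

text \<open>The separate subscript \<open>N\<close> lets the rule match products written with any of
  the mode counts of the theorem.\<close>

lemma matrix_einstein:
  assumes "A \<in> tensor_space (I @ J)" "B \<in> tensor_space (J @ K)" "length J = N"
  shows "matrix I K (A *\<^bsub>N\<^esub> B) = matrix I J A \<cdot>\<^bsub>multi_indices J\<^esub> matrix J K B"
  using entry_einstein[OF assms(1,2)] assms(3)
  by (auto simp: matrix_def mprod_def fun_eq_iff intro!: sum.cong)

lemma matrix_conj_transpose:
  assumes "A \<in> tensor_space (I @ J)" "length I = M"
  shows "matrix J I (A\<^sup>H\<^bsub>M\<^esub>) = ct (matrix I J A)"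
  using entry_conj_transpose[OF assms(1)] assms(2) by (auto simp: matrix_def ct_def fun_eq_iff)

lemma einstein_in_tensor_space:
  assumes "A \<in> tensor_space (I @ J)" "B \<in> tensor_space (J @ K)" "length J = N"
  shows "A *\<^bsub>N\<^esub> B \<in> tensor_space (I @ K)"
  using dims_einstein[OF assms(1,2)] assms(3) by simp

section \<open>Moore--Penrose inverses of tensors\<close>

lemma hermitian_iff:
  assumes "X \<in> tensor_space (I @ I)" "length I = M"
  shows "X\<^sup>H\<^bsub>M\<^esub> = X \<longleftrightarrow> ct (matrix I I X) = matrix I I X"
  using matrix_inject[of "X\<^sup>H\<^bsub>M\<^esub>" I I X] matrix_conj_transpose[OF assms]
    dims_conj_transpose[OF assms(1)] assms by simp

lemma is_mp_inverse_iff: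
  assumes X: "X \<in> tensor_space (I @ J)" and M: "length I = M"
  shows "is_mp_inverse M X Y \<longleftrightarrow> Y \<in> tensor_space (J @ I) \<and>
    penrose (multi_indices I) (multi_indices J) (matrix I J X) (matrix J I Y)"
\<comment> \<open>The products have known sizes only when \<open>Y\<close> has the right shape;
  otherwise both sides fail on the shape condition.\<close>
proof (cases "Y \<in> tensor_space (J @ I)")
  case Y: True
  have d: "dims X = I @ J" using X by (simp add: tensor_space_def)
  have N: "tensor_order X - M = length J" using M by (simp add: d tensor_order_def)
  note XY = einstein_in_tensor_space[OF X Y refl] and YX = einstein_in_tensor_space[OF Y X M]
  show ?thesis
    using Y M
    by (simp add: is_mp_inverse_def Let_def N d penrose_def hermitian_iff[OF XY M]
        hermitian_iff[OF YX refl] matrix_einstein[OF X Y] matrix_einstein[OF Y X]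
        matrix_einstein[OF XY X] matrix_einstein[OF YX Y] del: ct_mprod
        flip: matrix_inject[OF einstein_in_tensor_space[OF XY X M] X]
          matrix_inject[OF einstein_in_tensor_space[OF YX Y refl] Y])
next
  case False
  then show ?thesis using assms by (auto simp: is_mp_inverse_def Let_def tensor_space_def)
qed

text \<open>Existence and uniqueness transfer from matrices and justify the definite
  description.\<close>

lemma mp_inverse_eq_iff:
  assumes X: "X \<in> tensor_space (I @ J)" and M: "length I = M"
  shows "X\<^sup>\<dagger>\<^bsub>M\<^esub> = Y \<longleftrightarrow> is_mp_inverse M X Y"
proof -
  have "\<exists>!Y. is_mp_inverse M X Y"
  proof (rule ex_ex1I)
    obtain F where "supported (multi_indices J) (multi_indices I) F"
      "penrose (multi_indices I) (multi_indices J) (matrix I J X) F"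
      using penrose_exists[OF finite_multi_indices finite_multi_indices supported_matrix] .
    then show "\<exists>Y. is_mp_inverse M X Y"
      unfolding is_mp_inverse_iff[OF assms] using matrix_surj by metis
  next
    fix Y Z assume "is_mp_inverse M X Y" "is_mp_inverse M X Z"
    then show "Y = Z"
      unfolding is_mp_inverse_iff[OF assms]
      using penrose_unique[OF finite_multi_indices finite_multi_indices] matrix_inject by blast
  qed
  then show ?thesis
    unfolding mp_inverse_def by (metis the_equality)
qed

theorem theorem3p4:
  fixes A B :: tensor and I J K :: "nat list" and M N L :: nat
  assumes "length I = M" and "length J = N" and "length K = L"
    and "A \<in> tensor_space (I @ J)" and "B \<in> tensor_space (J @ K)"
  shows "(A *\<^bsub>N\<^esub> B)\<^sup>\<dagger>\<^bsub>M\<^esub> = B\<^sup>\<dagger>\<^bsub>N\<^esub> *\<^bsub>N\<^esub> A\<^sup>\<dagger>\<^bsub>M\<^esub> \<longleftrightarrow>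
    A\<^sup>\<dagger>\<^bsub>M\<^esub> *\<^bsub>M\<^esub> A *\<^bsub>N\<^esub> B *\<^bsub>L\<^esub> B\<^sup>\<dagger>\<^bsub>N\<^esub> = B *\<^bsub>L\<^esub> B\<^sup>\<dagger>\<^bsub>N\<^esub> *\<^bsub>N\<^esub> A\<^sup>\<dagger>\<^bsub>M\<^esub> *\<^bsub>M\<^esub> A \<and>
    (A *\<^bsub>N\<^esub> B *\<^bsub>L\<^esub> B\<^sup>\<dagger>\<^bsub>N\<^esub> *\<^bsub>N\<^esub> A\<^sup>\<dagger>\<^bsub>M\<^esub>)\<^sup>H\<^bsub>M\<^esub> = A *\<^bsub>N\<^esub> B *\<^bsub>L\<^esub> B\<^sup>\<dagger>\<^bsub>N\<^esub> *\<^bsub>N\<^esub> A\<^sup>\<dagger>\<^bsub>M\<^esub> \<and>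
    (B\<^sup>\<dagger>\<^bsub>N\<^esub> *\<^bsub>N\<^esub> A\<^sup>\<dagger>\<^bsub>M\<^esub> *\<^bsub>M\<^esub> A *\<^bsub>N\<^esub> B)\<^sup>H\<^bsub>L\<^esub> = B\<^sup>\<dagger>\<^bsub>N\<^esub> *\<^bsub>N\<^esub> A\<^sup>\<dagger>\<^bsub>M\<^esub> *\<^bsub>M\<^esub> A *\<^bsub>N\<^esub> B"
proof -
  note l = assms(1-3) and A = assms(4) and B = assms(5)
  define A' where "A' = A\<^sup>\<dagger>\<^bsub>M\<^esub>"
  define B' where "B' = B\<^sup>\<dagger>\<^bsub>N\<^esub>"
  note T = einstein_in_tensor_space
  \<comment> \<open>Taking \<open>Y = A'\<close> makes the equation in
    \<open>mp_inverse_eq_iff\<close> hold by definition, which yields the Penrose equations.\<close>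
  have A': "A' \<in> tensor_space (J @ I)"
    and pA: "penrose (multi_indices I) (multi_indices J) (matrix I J A) (matrix J I A')"
    using mp_inverse_eq_iff[OF A l(1), of A'] is_mp_inverse_iff[OF A l(1)] by (simp_all add: A'_def)
  have B': "B' \<in> tensor_space (K @ J)"
    and pB: "penrose (multi_indices J) (multi_indices K) (matrix J K B) (matrix K J B')"
    using mp_inverse_eq_iff[OF B l(2), of B'] is_mp_inverse_iff[OF B l(2)] by (simp_all add: B'_def)
  \<comment> \<open>One size fact for each left-nested subproduct: \<open>PQ\<close> and
    \<open>QP\<close> belong to the two sides of (i), \<open>R\<close> and \<open>S\<close> to (ii)
    and (iii).\<close>
  note AB = T[OF A B l(2)] and BA = T[OF B' A' l(2)]
  note PA = T[OF A' A l(1)] and QB = T[OF B B' l(3)]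
  note PB = T[OF PA B l(2)] and QA = T[OF QB A' l(2)]
  note PQ = T[OF PB B' l(3)] and QP = T[OF QA A l(1)]
  note ABB = T[OF AB B' l(3)] and BAA = T[OF BA A l(1)]
  note R = T[OF ABB A' l(2)] and S = T[OF BAA B l(2)]
  note m = matrix_einstein[OF A B l(2)] matrix_einstein[OF B' A' l(2)]
    matrix_einstein[OF A' A l(1)] matrix_einstein[OF B B' l(3)]
    matrix_einstein[OF PA B l(2)] matrix_einstein[OF QB A' l(2)]
    matrix_einstein[OF PB B' l(3)] matrix_einstein[OF QA A l(1)]
    matrix_einstein[OF AB B' l(3)] matrix_einstein[OF BA A l(1)]
    matrix_einstein[OF ABB A' l(2)] matrix_einstein[OF BAA B l(2)]
  have "(A *\<^bsub>N\<^esub> B)\<^sup>\<dagger>\<^bsub>M\<^esub> = B' *\<^bsub>N\<^esub> A' \<longleftrightarrow> penrose (multi_indices I) (multi_indices K)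
      (matrix I K (A *\<^bsub>N\<^esub> B)) (matrix K I (B' *\<^bsub>N\<^esub> A'))"
    using mp_inverse_eq_iff[OF AB l(1)] is_mp_inverse_iff[OF AB l(1)] BA by simp
  \<comment> \<open>Condition (i) passes to matrices by injectivity, (ii) and (iii) by
    \<open>hermitian_iff\<close>; the bracketing then agrees with
    \<open>penrose_mprod_iff\<close>.\<close>
  then show ?thesis
    unfolding A'_def[symmetric] B'_def[symmetric] matrix_inject[OF PQ QP, symmetric]
      hermitian_iff[OF R l(1)] hermitian_iff[OF S l(3)] m
    using penrose_mprod_iff[OF finite_multi_indices finite_multi_indices finite_multi_indices
        supported_matrix supported_matrix supported_matrix supported_matrix pA pB]
    by (simp only:)
qed

end
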